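(* Let $\mathcal R$ be a division ring of characteristic different from $2$ with a derivation ${}'$. Let $f_1,f_2,a,b\in\mathcal R$ satisfy $$f_1''+af_1'+bf_1=0,\qquad f_2''+af_2'+bf_2=0,$$ with $f_1,f_2$ invertible, and put $\varphi=f_1^{-1}f_2$, with $\varphi'$ invertible, and $\theta=\varphi''(\varphi')^{-1}$. If an invertible $h\in\mathcal R$ satisfies $h'=\frac12ha$, then the change $f_i\mapsto\tilde f_i=hf_i$, $i=1,2$, transforms the system into the system $\tilde f_i''+\tilde a\tilde f_i'+\tilde b\tilde f_i=0$ ($i=1,2$) with $$\tilde a=0,\qquad \tilde b=\frac12\,\tilde f_1\left(\theta'-\frac12\theta^2\right)\tilde f_1^{-1},$$ and the equation $2\tilde f_1'+\tilde f_1\theta=0$ holds.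
   Context: A derivation ${}'$ on $\mathcal R$ is an additive map with $(xy)'=x'y+xy'$; $x''=(x')'$. For invertible $g_1,g_2$ with $(g_1^{-1}g_2)'$ invertible, the coefficients $a,b$ of a system $g_i''+ag_i'+bg_i=0$, $i=1,2$, are uniquely determined by $g_1,g_2$. *)

theory Defs
  imports Complex_Main
begin

locale derivation = additive D for D :: "'a::ring \<Rightarrow> 'a" +
  assumes leibniz: "D (x * y) = D x * y + x * D y"

definition solves_system :: "('a::ring \<Rightarrow> 'a) \<Rightarrow> 'a \<Rightarrow> 'a \<Rightarrow> 'a \<Rightarrow> 'a \<Rightarrow> bool" where
  "solves_system D g\<^sub>1 g\<^sub>2 a b \<longleftrightarrow>
     D (D g\<^sub>1) + a * D g\<^sub>1 + b * g\<^sub>1 = 0 \<and> D (D g\<^sub>2) + a * D g\<^sub>2 + b * g\<^sub>2 = 0"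

end

theory Submission
  imports Defs
begin

text \<open>
  The factor \<open>h\<close> is chosen so that the first-order terms cancel, giving \<open>F'' = k F\<close> for both
  solutions with the same \<open>k\<close>. Substituting \<open>F\<^sub>2 = F\<^sub>1 \<phi>\<close> leaves \<open>2 F\<^sub>1' \<phi>' + F\<^sub>1 \<phi>'' = 0\<close>, which is the
  equation for \<open>\<theta>\<close>; differentiating it once more expresses \<open>F\<^sub>1''\<close>, hence \<open>k\<close>, through \<open>F\<^sub>1\<close> and \<open>\<theta>\<close>.
  Uniqueness of the coefficients holds because the two equations together force \<open>\<alpha> F\<^sub>1 \<phi>' = 0\<close>.
\<close>

text \<open>Otherwise the characteristic divides 2, so it is 1 or 2, and 1 is impossible because
  \<open>0 \<noteq> 1\<close> in a division ring.\<close>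

lemma two_neq_zero_of_CHAR:
  assumes "CHAR('a::division_ring) \<noteq> 2"
  shows "(2 :: 'a) \<noteq> 0"
proof
  assume "(2 :: 'a) = 0"
  then have "of_nat 2 = (0 :: 'a)"
    by simp
  then have "CHAR('a) dvd 2"
    by (simp only: of_nat_eq_0_iff_char_dvd)
  then have "CHAR('a) \<le> 2" and "CHAR('a) \<noteq> 0"
    using dvd_imp_le[of "CHAR('a)" 2] dvd_pos_nat[of 2 "CHAR('a)"] by auto
  moreover have "CHAR('a) \<noteq> 1"
    by simp
  ultimately show False
    using assms by linarith
qed

lemma half_mult_two:
  assumes "(2 :: 'a::division_ring) \<noteq> 0"
  shows "1 / 2 * (2 * x) = (x :: 'a)"
  using left_inverse[OF assms] by (simp only: divide_inverse mult_1_left mult.assoc[symmetric])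

text \<open>The ring need not be commutative, but 2 is central as a sum of ones, and hence so is its
  inverse.\<close>

lemma half_commute: "1 / 2 * x = x * (1 / 2)" for x :: "'a::division_ring"
proof (cases "(2 :: 'a) = 0")
  case False
  have "2 * x = x * 2"
    by (simp add: mult_2 mult_2_right)
  then show ?thesis
    using mult_commute_imp_mult_inverse_commute[of 2 x] by (simp only: divide_inverse mult_1_left)
\<comment> \<open>If 2 = 0, then \<open>1 / 2\<close> is 0 by the convention for division by
  zero.\<close>
qed simp

lemma half_double:
  fixes x :: "'a::division_ring"
  assumes "(2 :: 'a) \<noteq> 0"
  shows "1 / 2 * x + 1 / 2 * x = x"
  using half_mult_two[OF assms, of x] by (simp only: mult_2 distrib_left)

context derivation
begin

lemma second_leibniz: "D (D (x * y)) = D (D x) * y + (D x * D y + D x * D y) + x * D (D y)"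
  by (simp add: leibniz add algebra_simps)

text \<open>The two cross terms \<open>D h * D f\<close> add up to \<open>h * a * D f\<close>, the
  first-order term of the equation multiplied by \<open>h\<close>. The left factor that remains does
  not involve \<open>f\<close>.\<close>

lemma second_derivative_gauge:
  assumes "D (D f) + a * D f + b * f = 0" and "D h + D h = h * a"
  shows "D (D (h * f)) = (D (D h) - h * b) * f"
proof -
  have "D h * D f + D h * D f = h * a * D f"
    using assms(2) by (metis distrib_right)
  moreover have "h * D (D f) + h * (a * D f) + h * (b * f) = 0"
    using assms(1) by (simp flip: distrib_left)
  ultimately show ?thesis
    unfolding second_leibniz by (simp add: algebra_simps)
qed

end

lemma solves_system_mult_iff:
  fixes D :: "'a::division_ring \<Rightarrow> 'a"
  assumes "derivation D" and "F \<noteq> 0" and "D \<phi> \<noteq> 0"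
    and D2: "D (D (F * \<phi>)) = D (D F) * \<phi>"
  shows "solves_system D F (F * \<phi>) \<alpha> \<beta> \<longleftrightarrow> \<alpha> = 0 \<and> D (D F) + \<beta> * F = 0"
proof -
  interpret derivation D by fact
  \<comment> \<open>Coefficients act from the left, so by \<open>D2\<close> right multiplication by
    \<phi> passes through the operator, except where the first-order term differentiates
    \<phi>.\<close>
  have eq: "D (D (F * \<phi>)) + \<alpha> * D (F * \<phi>) + \<beta> * (F * \<phi>) =
      (D (D F) + \<alpha> * D F + \<beta> * F) * \<phi> + \<alpha> * F * D \<phi>"
    unfolding D2 by (simp add: leibniz algebra_simps)
  show ?thesis
    unfolding solves_system_def eq using assms(2,3) by auto
qed

lemma second_derivative_of_log_derivative:
  fixes D :: "'a::division_ring \<Rightarrow> 'a"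
  assumes "derivation D" and two: "(2 :: 'a) \<noteq> 0" and eq: "2 * D F + F * \<theta> = 0"
  shows "D (D F) = - (1 / 2 * F * (D \<theta> - 1 / 2 * \<theta>\<^sup>2))"
proof -
  interpret derivation D by fact
  have DF: "D F = - (1 / 2 * (F * \<theta>))"
  proof -
    have "D F = 1 / 2 * (2 * D F)"
      by (simp only: half_mult_two[OF two])
    also have "2 * D F = - (F * \<theta>)"
      using eq by (simp add: add_eq_0_iff2)
    finally show ?thesis
      by simp
  qed
  \<comment> \<open>Differentiating before halving avoids computing the derivative of
    \<open>1 / 2\<close>.\<close>
  have "2 * D (D F) + (D F * \<theta> + F * D \<theta>) = D (2 * D F + F * \<theta>)"
    by (simp add: mult_2 add leibniz)
  also have "\<dots> = 0"
    by (simp add: eq zero)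
  finally have "2 * D (D F) = - (D F * \<theta> + F * D \<theta>)"
    by (simp add: add_eq_0_iff2)
  also have "\<dots> = - (F * (D \<theta> - 1 / 2 * \<theta>\<^sup>2))"
  proof -
    have "1 / 2 * (F * \<theta>) * \<theta> = F * (1 / 2 * \<theta>\<^sup>2)"
      by (simp only: power2_eq_square mult.assoc[symmetric] half_commute[of F])
    then show ?thesis
      unfolding DF by (simp add: algebra_simps)
  qed
  finally have "1 / 2 * (2 * D (D F)) = 1 / 2 * - (F * (D \<theta> - 1 / 2 * \<theta>\<^sup>2))"
    by (rule arg_cong)
  then show ?thesis
    unfolding half_mult_two[OF two] by (simp add: mult.assoc)
qed

theorem theorem6p5:
  fixes D :: "'a::division_ring \<Rightarrow> 'a"
    and f\<^sub>1 f\<^sub>2 a b h \<phi> \<theta> F\<^sub>1 F\<^sub>2 :: 'a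
  assumes char: "CHAR('a) \<noteq> 2"
    and deriv: "derivation D"
    and sys: "solves_system D f\<^sub>1 f\<^sub>2 a b"
    and f\<^sub>1: "f\<^sub>1 \<noteq> 0" and f\<^sub>2: "f\<^sub>2 \<noteq> 0"
    and \<phi>: "\<phi> = inverse f\<^sub>1 * f\<^sub>2" and D\<phi>: "D \<phi> \<noteq> 0"
    and \<theta>: "\<theta> = D (D \<phi>) * inverse (D \<phi>)"
    and h: "h \<noteq> 0" and Dh: "D h = 1 / 2 * h * a"
    and F\<^sub>1: "F\<^sub>1 = h * f\<^sub>1" and F\<^sub>2: "F\<^sub>2 = h * f\<^sub>2"
  shows "(\<forall>\<alpha> \<beta>. solves_system D F\<^sub>1 F\<^sub>2 \<alpha> \<beta> \<longleftrightarrow>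
            \<alpha> = 0 \<and> \<beta> = 1 / 2 * F\<^sub>1 * (D \<theta> - 1 / 2 * \<theta>\<^sup>2) * inverse F\<^sub>1)
         \<and> 2 * D F\<^sub>1 + F\<^sub>1 * \<theta> = 0"
proof -
  interpret derivation D by (fact deriv)
  have two: "(2 :: 'a) \<noteq> 0"
    using char by (rule two_neq_zero_of_CHAR)
  have F0: "F\<^sub>1 \<noteq> 0"
    using F\<^sub>1 f\<^sub>1 h by simp
  have f2: "f\<^sub>2 = f\<^sub>1 * \<phi>"
    using \<phi> f\<^sub>1 by (simp add: mult.assoc[symmetric])
  have F2: "F\<^sub>2 = F\<^sub>1 * \<phi>"
    by (simp add: F\<^sub>1 F\<^sub>2 f2 mult.assoc)
  have "D h + D h = h * a"
    using half_double[OF two] by (simp add: Dh mult.assoc)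
  with sys have "D (D F\<^sub>1) = (D (D h) - h * b) * f\<^sub>1" "D (D F\<^sub>2) = (D (D h) - h * b) * f\<^sub>2"
    unfolding F\<^sub>1 F\<^sub>2 solves_system_def by (blast intro: second_derivative_gauge)+
  \<comment> \<open>Both second derivatives have the same left factor, and \<open>f\<^sub>2\<close>
    is \<open>f\<^sub>1\<close> times \<phi> on the right.\<close>
  then have D2: "D (D (F\<^sub>1 * \<phi>)) = D (D F\<^sub>1) * \<phi>"
    by (simp only: F2[symmetric]) (simp only: f2 mult.assoc)
  \<comment> \<open>Multiplying by \<open>D \<phi>\<close> clears the inverse in \<theta> and leaves
    the Leibniz terms of \<open>D (D (F\<^sub>1 * \<phi>))\<close> other than
    \<open>D (D F\<^sub>1) * \<phi>\<close>; by \<open>D2\<close> they sum to 0.\<close>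
  have "(2 * D F\<^sub>1 + F\<^sub>1 * \<theta>) * D \<phi> = D F\<^sub>1 * D \<phi> + D F\<^sub>1 * D \<phi> + F\<^sub>1 * D (D \<phi>)"
    using D\<phi> by (simp add: \<theta> mult_2 algebra_simps)
  also have "\<dots> = 0"
    using D2 unfolding second_leibniz by simp
  finally have first: "2 * D F\<^sub>1 + F\<^sub>1 * \<theta> = 0"
    using D\<phi> by simp
  have D2F: "D (D F\<^sub>1) = - (1 / 2 * F\<^sub>1 * (D \<theta> - 1 / 2 * \<theta>\<^sup>2))"
    using deriv two first by (rule second_derivative_of_log_derivative)
  have "D (D F\<^sub>1) + \<beta> * F\<^sub>1 = 0 \<longleftrightarrow>
      \<beta> = 1 / 2 * F\<^sub>1 * (D \<theta> - 1 / 2 * \<theta>\<^sup>2) * inverse F\<^sub>1" for \<beta>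
    unfolding D2F using F0 by (auto simp: divide_inverse[symmetric] eq_divide_eq)
  then show ?thesis
    using first solves_system_mult_iff[OF deriv F0 D\<phi> D2] by (simp add: F2)
qed

end
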